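(* The positive integers $n$ such that both $n$ and $d(n)$ are highly composite are exactly the following $18$ numbers: $1$, $2$, $6$, $12$, $60$, $360$, $1260$, $2520$, $5040$, $55440$, $277200$, $720720$, $3603600$, $61261200$, $2205403200$, $293318625600$, $6746328388800$, $195643523275200$. The corresponding values of $d(n)$ are, in the same order, $1$, $2$, $4$, $6$, $12$, $24$, $36$, $48$, $60$, $120$, $180$, $240$, $360$, $720$, $1680$, $5040$, $10080$, $20160$.
   Context: For a positive integer $n$, $d(n)=\sum_{d\mid n}1$ denotes the number of positive divisors of $n$. A positive integer $n$ is called highly composite if $d(m)<d(n)$ for every positive integer $m<n$. *)

theory Defs
  imports Main
begin

definition num_divisors :: "nat \<Rightarrow> nat" where
  "num_divisors n = card {k. k dvd n}"

definition highly_composite :: "nat \<Rightarrow> bool" where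
  "highly_composite n \<longleftrightarrow> n > 0 \<and> (\<forall>m. 0 < m \<and> m < n \<longrightarrow> num_divisors m < num_divisors n)"

end

theory Submission
  imports Defs "HOL-Number_Theory.Number_Theory" "HOL-Library.Code_Binary_Nat"
begin

text \<open>Let \<open>n\<close> and \<open>N = d(n)\<close> be highly composite and let \<open>n\<close> have \<open>w\<close> prime factors. Almost all of
  them occur to the first power (exchanging three squared primes for the two least missing ones would
  otherwise give a smaller number with more divisors), and each of those contributes a factor \<open>2\<close> to
  \<open>N\<close>. On the other hand the exponents of \<open>n\<close> are \<open>O(log w)\<close>, so the primes dividing \<open>N\<close> are
  \<open>O(log w)\<close>, and as \<open>N\<close> is highly composite its exponent of \<open>2\<close> is only \<open>O(log (log w))\<close>. Together
  with an elementary Chebyshev bound this forces \<open>w \<le> 14\<close>, so that some prime up to \<open>47\<close> does not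
  divide \<open>n\<close>.

  Exchange arguments then confine \<open>n\<close> and \<open>N\<close> to the divisors of one explicit number. The divisors
  that are not beaten by a smaller divisor with as many divisors form a list that can be computed
  prime by prime; \<open>n\<close> and \<open>N\<close> are both entries of that list.\<close>

section \<open>The divisor function\<close>

lemma num_divisors_mult_coprime:
  assumes "coprime m n"
  shows "num_divisors (m * n) = num_divisors m * num_divisors n"
proof -
  let ?f = "\<lambda>(a, b). a * b :: nat"
  have "inj_on ?f ({a. a dvd m} \<times> {b. b dvd n})"
  proof (rule inj_onI, clarify)
    fix a b a' b'
    assume d: "a dvd m" "b dvd n" "a' dvd m" "b' dvd n" and eq: "a * b = a' * b'"
    have c: "coprime a b'" "coprime a' b"
      using coprime_divisors[OF d(1,4) assms] coprime_divisors[OF d(3,2) assms] .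
    have "a dvd a'" "a' dvd a"
      using eq c by (metis coprime_dvd_mult_left_iff dvd_triv_left)+
    moreover have "b dvd b'" "b' dvd b"
      using eq c by (metis coprime_commute coprime_dvd_mult_right_iff dvd_triv_right)+
    ultimately show "a = a' \<and> b = b'"
      by (simp add: dvd_antisym)
  qed
  moreover have "?f ` ({a. a dvd m} \<times> {b. b dvd n}) = {k. k dvd m * n}"
  proof (intro equalityI subsetI)
    fix k assume "k \<in> {k. k dvd m * n}"
    then obtain a b where "k = a * b" "a dvd m" "b dvd n"
      using division_decomp by blast
    then show "k \<in> ?f ` ({a. a dvd m} \<times> {b. b dvd n})" by force
  qed (auto intro: mult_dvd_mono)
  ultimately have "card {k. k dvd m * n} = card ({a. a dvd m} \<times> {b. b dvd n})"
    by (metis card_image)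
  then show ?thesis
    by (simp add: num_divisors_def card_cartesian_product)
qed

lemma num_divisors_prime_power:
  assumes "prime p"
  shows "num_divisors (p ^ a) = Suc a"
proof -
  have "{k. k dvd p ^ a} = (^) p ` {..a}"
    using assms by (auto simp: divides_primepow_nat)
  moreover have "inj_on ((^) p) {..a}"
    using assms prime_gt_1_nat by (auto intro!: inj_onI)
  ultimately show ?thesis
    by (simp add: num_divisors_def card_image)
qed

lemma num_divisors_prime_power_mult:
  assumes "prime p" "\<not> p dvd m"
  shows "num_divisors (p ^ a * m) = Suc a * num_divisors m"
  using assms
  by (simp add: num_divisors_mult_coprime num_divisors_prime_power prime_imp_coprime)

lemma num_divisors_prime_mult:
  assumes "prime p" "\<not> p dvd m"
  shows "num_divisors (p * m) = 2 * num_divisors m"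
  using num_divisors_prime_power_mult[OF assms, of 1] by simp

lemma prime_not_dvd_prime_power_mult:
  fixes p q m :: nat
  assumes "prime p" "prime q" "p \<noteq> q" "\<not> p dvd m"
  shows "\<not> p dvd q ^ k * m" "\<not> p dvd q * m"
  using assms by (metis prime_dvd_mult_iff prime_dvd_power primes_dvd_imp_eq)+

lemmas num_divisors_simps =
  num_divisors_prime_power_mult num_divisors_prime_mult prime_not_dvd_prime_power_mult

lemma num_divisors_prod_prime_powers:
  assumes "finite S" "\<And>p. p \<in> S \<Longrightarrow> prime p"
  shows "num_divisors (\<Prod>p\<in>S. p ^ f p) = (\<Prod>p\<in>S. Suc (f p))"
  using assms
proof (induction S rule: finite_induct)
  case empty
  show ?case by (simp add: num_divisors_def)
next
  case (insert q S)
  have "\<not> q dvd (\<Prod>p\<in>S. p ^ f p)"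
    using insert by (auto simp: prime_dvd_prod_iff) (metis prime_dvd_power primes_dvd_imp_eq)
  then show ?case
    using insert by (simp add: num_divisors_prime_power_mult)
qed

lemma num_divisors_eq_prod:
  assumes "n > 0"
  shows "num_divisors n = (\<Prod>p\<in>prime_factors n. Suc (multiplicity p n))"
  using num_divisors_prod_prime_powers[of "prime_factors n" "\<lambda>p. multiplicity p n"]
    prime_factorization_nat[OF assms, symmetric] by (simp add: in_prime_factors_imp_prime)

lemma highly_composite_pos: "highly_composite n \<Longrightarrow> n > 0"
  by (simp add: highly_composite_def)

text \<open>The exchange arguments end with this: a competitor \<open>m\<close> built with at least
  as many divisors as \<open>n\<close>, but visibly smaller than \<open>n\<close>, is a
  contradiction.\<close>

lemma highly_composite_le:
  "highly_composite n \<Longrightarrow> 0 < m \<Longrightarrow> num_divisors n \<le> num_divisors m \<Longrightarrow> n \<le> m"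
  unfolding highly_composite_def by (meson not_le)

lemma prime_power_split:
  fixes n :: nat
  assumes "n > 0" "prime p"
  obtains w where "n = p ^ multiplicity p n * w" "\<not> p dvd w" "w > 0"
proof -
  obtain w where "n = p ^ multiplicity p n * w" "\<not> p dvd w"
    using multiplicity_decompose'[of n p] assms by (metis not_prime_unit not_gr0)
  then show ?thesis using that assms by (metis mult_0_right gr0I)
qed

section \<open>Exchange arguments\<close>

text \<open>Let \<open>a\<close> be the exponent of \<open>r\<close>. Trading \<open>r ^ m\<close>
  for the missing prime \<open>P\<close> makes \<open>n\<close> smaller and changes the number of
  divisors by the factor \<open>2 * (a - m + 1) / (a + 1)\<close>, which is at least 1 once
  \<open>a >= 2 * m - 1\<close>.\<close>

lemma highly_composite_exponent_bound:
  assumes n: "highly_composite n" and P: "prime P" "\<not> P dvd n" and r: "prime r" "P < r ^ m"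
  shows "\<not> r ^ (2 * m - 1) dvd n"
proof
  assume dvd: "r ^ (2 * m - 1) dvd n"
  have "m > 0" using P r by (intro gr0I) (auto dest: prime_gt_1_nat)
  then have "r dvd r ^ (2 * m - 1)" by (intro dvd_power) auto
  then have "r dvd n" using dvd dvd_trans by blast
  then have "r \<noteq> P" using P by blast
  define a where "a = multiplicity r n"
  obtain w where w: "n = r ^ a * w" "\<not> r dvd w" "w > 0"
    using prime_power_split[OF highly_composite_pos[OF n] r(1)] unfolding a_def by blast
  have "2 * m - 1 \<le> a"
    unfolding a_def using dvd highly_composite_pos[OF n] r(1)
    by (intro multiplicity_geI) (auto dest: prime_gt_1_nat)
  then have a: "m \<le> a" "Suc a \<le> 2 * Suc (a - m)" using \<open>m > 0\<close> by auto
  have Pw: "\<not> P dvd w" using P w by auto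
  have rPw: "\<not> r dvd P * w"
    using w r P \<open>r \<noteq> P\<close> by (auto simp: prime_dvd_mult_iff primes_dvd_imp_eq)
  have "num_divisors n = Suc a * num_divisors w"
    using w r by (simp add: num_divisors_prime_power_mult)
  also have "\<dots> \<le> 2 * Suc (a - m) * num_divisors w" using a by (intro mult_right_mono) auto
  also have "\<dots> = num_divisors (r ^ (a - m) * (P * w))"
    using num_divisors_prime_power_mult[OF r(1) rPw] num_divisors_prime_power_mult[OF P(1) Pw, of 1]
    by simp
  finally have "n \<le> r ^ (a - m) * (P * w)"
    using P r w by (intro highly_composite_le[OF n]) (auto dest: prime_gt_0_nat)
  also have "\<dots> < r ^ (a - m) * (r ^ m * w)" using P r w by (auto dest: prime_gt_0_nat)
  also have "\<dots> = n" using a w by (simp add: mult.assoc[symmetric] flip: power_add)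
  finally show False by simp
qed

text \<open>\<open>n * P * Q / (r1 * r2 * r3)\<close> has at least \<open>2 * 2 * (2/3)^3 > 1\<close> times as many divisors as \<open>n\<close>.\<close>

lemma highly_composite_three_squares:
  assumes n: "highly_composite n" and P: "prime P" "\<not> P dvd n" and Q: "prime Q" "\<not> Q dvd n"
    and "P \<noteq> Q" and r: "prime r1" "prime r2" "prime r3" "r1 \<noteq> r2" "r1 \<noteq> r3" "r2 \<noteq> r3"
    and dvd: "r1\<^sup>2 dvd n" "r2\<^sup>2 dvd n" "r3\<^sup>2 dvd n"
  shows "r1 * r2 * r3 \<le> P * Q"
proof (rule ccontr)
  assume "\<not> ?thesis"
  then have less: "P * Q < r1 * r2 * r3" by simp
  define a where "a = multiplicity r1 n"
  obtain u where u: "n = r1 ^ a * u" "\<not> r1 dvd u" "u > 0"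
    using prime_power_split[OF highly_composite_pos[OF n] r(1)] unfolding a_def by blast
  define b where "b = multiplicity r2 u"
  obtain v where v: "u = r2 ^ b * v" "\<not> r2 dvd v" "v > 0"
    using prime_power_split[OF u(3) r(2)] unfolding b_def by blast
  define c where "c = multiplicity r3 v"
  obtain w where w: "v = r3 ^ c * w" "\<not> r3 dvd w" "w > 0"
    using prime_power_split[OF v(3) r(3)] unfolding c_def by blast
  have n_eq: "n = r1 ^ a * (r2 ^ b * (r3 ^ c * w))" using u v w by simp
  have ne: "P \<noteq> r1" "P \<noteq> r2" "P \<noteq> r3" "Q \<noteq> r1" "Q \<noteq> r2" "Q \<noteq> r3"
    using P Q dvd by (auto dest: dvd_trans[rotated] simp: power2_eq_square)
  have cop: "coprime r1 r2" "coprime r1 r3" "coprime r2 r3"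
    using r by (auto intro: primes_coprime)
  have "2 \<le> a"
    unfolding a_def using dvd n r by (intro multiplicity_geI) (auto dest: prime_gt_1_nat highly_composite_pos)
  have "r2\<^sup>2 dvd u" using dvd(2) cop u(1)
    by (metis coprime_commute coprime_dvd_mult_right_iff coprime_power_left_iff coprime_power_right_iff)
  then have "2 \<le> b"
    unfolding b_def using u r by (intro multiplicity_geI) (auto dest: prime_gt_1_nat)
  have "r3\<^sup>2 dvd u" using dvd(3) cop u(1)
    by (metis coprime_commute coprime_dvd_mult_right_iff coprime_power_left_iff coprime_power_right_iff)
  then have "r3\<^sup>2 dvd v" using cop v(1)
    by (metis coprime_commute coprime_dvd_mult_right_iff coprime_power_left_iff coprime_power_right_iff)
  then have "2 \<le> c"
    unfolding c_def using v r by (intro multiplicity_geI) (auto dest: prime_gt_1_nat)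
  obtain a' b' c' where abc: "a = Suc a'" "b = Suc b'" "c = Suc c'" "1 \<le> a'" "1 \<le> b'" "1 \<le> c'"
    using \<open>2 \<le> a\<close> \<open>2 \<le> b\<close> \<open>2 \<le> c\<close> by (metis Suc_le_D Suc_le_mono numeral_2_eq_2 One_nat_def)
  have nd: "\<not> r1 dvd w" "\<not> r2 dvd w" "\<not> r3 dvd w" "\<not> P dvd w" "\<not> Q dvd w"
    using u v w P Q n_eq by auto
  have dn: "num_divisors n = Suc a * Suc b * Suc c * num_divisors w"
    unfolding n_eq using r nd by (simp add: num_divisors_simps) (simp add: algebra_simps)
  let ?m = "r1 ^ a' * (r2 ^ b' * (r3 ^ c' * (P * (Q * w))))"
  have dm: "num_divisors ?m = a * b * c * 4 * num_divisors w"
    using r nd ne[symmetric] P Q \<open>P \<noteq> Q\<close> abc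
    by (simp add: num_divisors_simps) (simp add: algebra_simps)
  have le: "2 * Suc a \<le> 3 * a" "2 * Suc b \<le> 3 * b" "2 * Suc c \<le> 3 * c"
    using \<open>2 \<le> a\<close> \<open>2 \<le> b\<close> \<open>2 \<le> c\<close> by auto
  have "(2 * Suc a) * (2 * Suc b) * (2 * Suc c) \<le> (3 * a) * (3 * b) * (3 * c)"
    using mult_le_mono[OF mult_le_mono[OF le(1,2)] le(3)] .
  \<comment> \<open>Dividing by 8 leaves the factor 27 / 8, which is less than 4.\<close>
  then have "Suc a * Suc b * Suc c \<le> a * b * c * 4" by (simp add: algebra_simps)
  then have "num_divisors n \<le> num_divisors ?m"
    unfolding dn dm by (intro mult_right_mono) auto
  moreover have "0 < ?m" using r P Q w by (auto dest: prime_gt_0_nat)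
  ultimately have "n \<le> ?m" by (intro highly_composite_le[OF n])
  also have "?m = (r1 ^ a' * r2 ^ b' * r3 ^ c' * w) * (P * Q)" by simp
  also have "\<dots> < (r1 ^ a' * r2 ^ b' * r3 ^ c' * w) * (r1 * r2 * r3)"
    using less r w by (auto dest: prime_gt_0_nat)
  also have "\<dots> = n" unfolding n_eq abc by simp
  finally show False by simp
qed

text \<open>The competitor is \<open>n * P / (3 * r)\<close> if \<open>27\<close> divides \<open>n\<close>, and \<open>9 * n / r\<close> otherwise.\<close>

lemma highly_composite_not_square_dvd:
  assumes n: "highly_composite n" and P: "prime P" "\<not> P dvd n" "P \<le> 47" and r: "prime r" "17 \<le> r"
  shows "\<not> r\<^sup>2 dvd n"
proof
  assume dvd: "r\<^sup>2 dvd n"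
  define a where "a = multiplicity r n"
  obtain u where u: "n = r ^ a * u" "\<not> r dvd u" "u > 0"
    using prime_power_split[OF highly_composite_pos[OF n] r(1)] unfolding a_def by blast
  have p3: "prime (3::nat)" by simp
  define b where "b = multiplicity 3 u"
  obtain w where w: "u = 3 ^ b * w" "\<not> 3 dvd w" "w > 0"
    using prime_power_split[OF u(3) p3] unfolding b_def by blast
  have "2 \<le> a"
    unfolding a_def using dvd n r by (intro multiplicity_geI) (auto dest: prime_gt_1_nat highly_composite_pos)
  then obtain a' where a': "a = Suc a'" "1 \<le> a'" by (cases a) auto
  have n_eq: "n = r ^ a * (3 ^ b * w)" using u w by simp
  have nd: "\<not> r dvd w" "\<not> 3 dvd w" "\<not> P dvd w" using u w n_eq P by auto
  have "P \<noteq> r" using P dvd by (auto dest: dvd_trans[rotated] simp: power2_eq_square)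
  have dn: "num_divisors n = Suc a * (Suc b * num_divisors w)"
    unfolding n_eq using r nd p3 by (simp add: num_divisors_simps)
  show False
  proof (cases "3 \<le> b")
    case True
    then obtain b' where b': "b = Suc b'" "2 \<le> b'" by (cases b) auto
    have "P \<noteq> 3" using P n_eq b' by auto
    let ?m = "r ^ a' * (3 ^ b' * (P * w))"
    have dm: "num_divisors ?m = a * (b * (2 * num_divisors w))"
      using r nd p3 P \<open>P \<noteq> 3\<close>[symmetric] \<open>P \<noteq> r\<close>[symmetric] a' b' by (simp add: num_divisors_simps)
    \<comment> \<open>The difference \<open>2 * a * b - (a + 1) * (b + 1)\<close> equals
      \<open>a' * b' - 2\<close>.\<close>
    have "1 * 2 \<le> a' * b'" using a' b' by (intro mult_mono) auto
    then have "Suc a * Suc b \<le> a * b * 2" using a' b' by (simp add: algebra_simps)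
    then have "Suc a * Suc b * num_divisors w \<le> a * b * 2 * num_divisors w" by (rule mult_right_mono) simp
    then have "num_divisors n \<le> num_divisors ?m"
      unfolding dn dm by (simp only: mult.assoc)
    moreover have "0 < ?m" using r P w by (auto dest: prime_gt_0_nat)
    ultimately have "n \<le> ?m" by (intro highly_composite_le[OF n])
    also have "?m = (r ^ a' * 3 ^ b' * w) * P" by simp
    \<comment> \<open>Here \<open>P <= 47 < 3 * 17 <= 3 * r\<close>.\<close>
    also have "\<dots> < (r ^ a' * 3 ^ b' * w) * (r * 3)"
      using r w P(3) by (auto dest: prime_gt_0_nat)
    also have "\<dots> = n" unfolding n_eq a' b' by simp
    finally show False by simp
  next
    case False
    define e where "e = b + 2"
    let ?m = "r ^ a' * (3 ^ e * w)"
    have dm: "num_divisors ?m = a * ((b + 3) * num_divisors w)"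
      using r nd p3 a' by (simp add: num_divisors_simps) (simp add: e_def algebra_simps)
    \<comment> \<open>This amounts to \<open>b + 1 <= 2 * a\<close>, and
      \<open>b <= 2 <= a\<close>.\<close>
    have "Suc a * Suc b \<le> a * (b + 3)" using a' False by (simp add: algebra_simps)
    then have "Suc a * Suc b * num_divisors w \<le> a * (b + 3) * num_divisors w" by (rule mult_right_mono) simp
    then have "num_divisors n \<le> num_divisors ?m"
      unfolding dn dm by (simp only: mult.assoc)
    moreover have "0 < ?m" using r w by (auto dest: prime_gt_0_nat)
    ultimately have "n \<le> ?m" by (intro highly_composite_le[OF n])
    also have "?m = (r ^ a' * 3 ^ b * w) * 9" by (simp add: e_def power_add)
    also have "\<dots> < (r ^ a' * 3 ^ b * w) * r"
      using r w by (auto dest: prime_gt_0_nat)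
    also have "\<dots> = n" unfolding n_eq a' by simp
    finally show False by simp
  qed
qed

section \<open>Counting primes\<close>

text \<open>With \<open>l n k = 1 / (k * (n choose k))\<close>, Leibniz' harmonic triangle gives
  \<open>l n k = l (n - 1) k - l n (k + 1)\<close>, so \<open>L * l n k\<close> is an integer by induction on \<open>n - k\<close>.\<close>

lemma mult_binomial_dvd:
  assumes "1 \<le> k" "k \<le> n" "\<And>i. 1 \<le> i \<Longrightarrow> i \<le> n \<Longrightarrow> i dvd L"
  shows "k * (n choose k) dvd L"
  using assms
proof (induction "n - k" arbitrary: n k)
  case 0
  then show ?case by simp
next
  case (Suc d)
  then obtain m where m: "n = Suc m" "k \<le> m" by (cases n) auto
  have "k * (m choose k) dvd L" using Suc.hyps(1)[of m k] Suc m by auto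
  then obtain x where x: "L = k * (m choose k) * x" by (rule dvdE)
  have "Suc k * (n choose Suc k) dvd L" using Suc.hyps(1)[of n "Suc k"] Suc m by auto
  then obtain y where y: "L = Suc k * (n choose Suc k) * y" by (rule dvdE)
  define A B C where "A = real (m choose k)" and "B = real (n choose k)" and "C = real (n choose Suc k)"
  have B: "real (n - k) * B = real n * A"
    using binomial_absorb_comp[of n k] m unfolding A_def B_def by (metis diff_Suc_1 of_nat_mult)
  have C: "real (Suc k) * C = real n * A"
    using Suc_times_binomial[of k m] m unfolding A_def C_def by (metis of_nat_mult)
  have L: "real L = real k * A * real x" "real L = real (Suc k) * C * real y"
    unfolding A_def C_def by (subst x, simp only: of_nat_mult) (subst y, simp only: of_nat_mult)
  \<comment> \<open>The integers \<open>x\<close> and \<open>y\<close> are \<open>L * l m k\<close>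
    and \<open>L * l n (k + 1)\<close>, so the triangle identity makes \<open>x - y\<close> equal to
    \<open>L * l n k\<close>. It is verified after multiplication by \<open>n - k\<close>, which is
    nonzero as \<open>k <= m\<close>.\<close>
  have "real L = k * B * (real x - real y)"
  proof -
    have n: "real n = real (n - k) + real k" using m by simp
    have "real (n - k) * (real k * B * (real x - real y)) = (real (n - k) * B) * (real k * (real x - real y))"
      by (simp only: mult_ac)
    also have "\<dots> = (real n * A) * (real k * (real x - real y))" by (simp only: B)
    also have "\<dots> = real n * (real k * A * real x) - real k * (real n * A * real y)"
      by (simp add: right_diff_distrib mult_ac)
    also have "\<dots> = real n * real L - real k * real L"
      by (simp only: L(1)[symmetric] C[symmetric] L(2)[symmetric])
    also have "\<dots> = real (n - k) * real L" by (subst n) (simp only: distrib_right add_diff_cancel_right')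
    finally show ?thesis using m by simp
  qed
  then have "real_of_int (int L) = real_of_int (int (k * (n choose k)) * (int x - int y))"
    unfolding B_def by simp
  then have "int L = int (k * (n choose k)) * (int x - int y)"
    by (simp only: of_int_eq_iff)
  then show ?case by (metis dvd_triv_left int_dvd_int_iff)
qed

definition primes_below :: "nat \<Rightarrow> nat set" where
  "primes_below x = {p. prime p \<and> p < x}"

lemma finite_primes_below [simp]: "finite (primes_below x)"
  by (simp add: primes_below_def)

text \<open>The witness is the least common multiple of \<open>1, ..., n\<close>: each prime enters
  with its largest power not exceeding \<open>n\<close>, so every factor is at most
  \<open>n\<close>.\<close>

lemma common_multiple_le_power_card_primes:
  assumes "n > 0"
  obtains L where "L > 0" "L \<le> n ^ card (primes_below (Suc n))" "\<And>i. 1 \<le> i \<Longrightarrow> i \<le> n \<Longrightarrow> i dvd L"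
proof -
  have "\<forall>p\<in>primes_below (Suc n). \<exists>e. p ^ e \<le> n \<and> n < p ^ (e + 1)"
    using assms ex_power_ivl1 by (auto simp: primes_below_def Suc_leI dest: prime_ge_2_nat simp del: power_Suc)
  then obtain e where e: "\<And>p. p \<in> primes_below (Suc n) \<Longrightarrow> p ^ e p \<le> n \<and> n < p ^ (e p + 1)"
    by (metis (no_types, lifting))
  let ?L = "\<Prod>p\<in>primes_below (Suc n). p ^ e p"
  show ?thesis
  proof
    show "?L > 0" by (auto intro!: prod_pos simp: primes_below_def dest: prime_gt_0_nat)
    show "?L \<le> n ^ card (primes_below (Suc n))"
      using e by (intro prod_le_power) (auto simp: assms Suc_leI)
    fix i assume i: "1 \<le> i" "i \<le> n"
    have pf: "prime_factors i \<subseteq> primes_below (Suc n)"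
      using i by (auto simp: primes_below_def prime_factors_dvd dest: dvd_imp_le)
    have "i = (\<Prod>p\<in>prime_factors i. p ^ multiplicity p i)" using i prime_factorization_nat[of i] by simp
    also have "\<dots> dvd ?L"
    proof (rule prod_dvd_prod_subset2)
      show "finite (primes_below (Suc n))" by simp
      show "prime_factors i \<subseteq> primes_below (Suc n)" by (rule pf)
      fix p assume p: "p \<in> prime_factors i"
      have "p ^ multiplicity p i \<le> i" using i by (intro dvd_imp_le multiplicity_dvd) auto
      also have "\<dots> < p ^ (e p + 1)" using e pf p i by (meson le_less_trans subsetD)
      finally have "multiplicity p i \<le> e p"
        using prime_gt_1_nat[OF in_prime_factors_imp_prime[OF p]]
        by (subst (asm) power_strict_increasing_iff) auto
      then show "p ^ multiplicity p i dvd p ^ e p" by (rule le_imp_power_dvd)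
    qed
    finally show "i dvd ?L" .
  qed
qed

text \<open>A Chebyshev bound: \<open>h * (2 * h choose h)\<close> is at least \<open>4 ^ h / 2\<close> and divides a common
  multiple of \<open>1, ..., 2 * h\<close>.\<close>

lemma card_primes_below_power_2_ge:
  assumes "2 \<le> s"
  shows "2 ^ s \<le> s * card (primes_below (2 ^ s)) + 1"
proof -
  define h :: nat where "h = 2 ^ (s - 1)"
  have h: "2 * h = 2 ^ s" "h > 0" using assms unfolding h_def by (simp_all flip: power_Suc)
  obtain L where L: "L > 0" "L \<le> (2 ^ s) ^ card (primes_below (Suc (2 ^ s)))"
      "\<And>i::nat. 1 \<le> i \<Longrightarrow> i \<le> 2 ^ s \<Longrightarrow> i dvd L"
    using common_multiple_le_power_card_primes[of "2 ^ s"] by (metis pos2 zero_less_power)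
  \<comment> \<open>The multiple covers \<open>2 ^ s\<close> itself, while the count is of primes
    strictly below; as \<open>2 ^ s\<close> is composite the two counts agree.\<close>
  have "\<not> prime ((2::nat) ^ s)" using assms by (auto simp: prime_power_iff)
  then have pb: "primes_below (Suc (2 ^ s)) = primes_below (2 ^ s)"
    unfolding primes_below_def by (auto simp: less_Suc_eq)
  have "h * (2 * h choose h) dvd L"
    using L(3) h by (intro mult_binomial_dvd) auto
  then have "h * (2 * h choose h) \<le> L" using L(1) by (rule dvd_imp_le)
  moreover have "real (4 ^ h) \<le> real (2 * (h * (2 * h choose h)))"
    using central_binomial_lower_bound[OF h(2)] h(2) by (simp add: field_simps)
  then have "4 ^ h \<le> 2 * (h * (2 * h choose h))" by (simp only: of_nat_le_iff)
  ultimately have "(4::nat) ^ h \<le> 2 * (2 ^ s) ^ card (primes_below (2 ^ s))"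
    using L(2) unfolding pb by (meson le_trans mult_le_mono2)
  \<comment> \<open>Both sides become powers of 2, and comparing exponents gives the bound.\<close>
  moreover have "(4::nat) ^ h = 2 ^ (2 ^ s)" unfolding h(1)[symmetric] by (simp add: power_mult)
  moreover have "2 * (2 ^ s) ^ card (primes_below (2 ^ s)) = (2::nat) ^ Suc (s * card (primes_below (2 ^ s)))"
    by (simp only: power_Suc power_mult)
  ultimately have "(2::nat) ^ (2 ^ s) \<le> 2 ^ Suc (s * card (primes_below (2 ^ s)))" by metis
  then have "2 ^ s \<le> Suc (s * card (primes_below (2 ^ s)))"
    by (subst (asm) power_increasing_iff) auto
  then show ?thesis by (simp only: Suc_eq_plus1)
qed

text \<open>Besides 2, only the \<open>h - 1\<close> odd numbers from 3 to \<open>2 * h - 1\<close>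
  are candidates.\<close>

lemma card_primes_below_le:
  assumes "1 \<le> h"
  shows "card (primes_below (2 * h)) \<le> h"
proof -
  have "primes_below (2 * h) \<subseteq> insert 2 ((\<lambda>i. 2 * i + 1) ` {1..<h})"
  proof
    fix p assume "p \<in> primes_below (2 * h)"
    then have p: "prime p" "p < 2 * h" by (auto simp: primes_below_def)
    show "p \<in> insert 2 ((\<lambda>i. 2 * i + 1) ` {1..<h})"
    proof (cases "p = 2")
      case False
      then have "odd p" using p prime_odd_nat prime_ge_2_nat by (metis le_neq_implies_less)
      then obtain i where "p = 2 * i + 1" by (rule oddE)
      then show ?thesis using p prime_ge_2_nat[OF p(1)] by auto
    qed auto
  qed
  then have "card (primes_below (2 * h)) \<le> card (insert 2 ((\<lambda>i. 2 * i + 1) ` {1..<h}))"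
    by (intro card_mono) auto
  also have "\<dots> \<le> Suc (card {1..<h})"
    using card_image_le[of "{1..<h}" "\<lambda>i. 2 * i + 1"] by (simp add: card_insert_if)
  finally show ?thesis using assms by simp
qed

definition primes_list_128 :: "nat list" where
  "primes_list_128 = [2, 3, 5, 7, 11, 13, 17, 19, 23, 29, 31, 37, 41, 43, 47, 53, 59, 61, 67, 71,
    73, 79, 83, 89, 97, 101, 103, 107, 109, 113, 127]"

lemma primes_below_eq_list:
  assumes "x \<le> 128"
  shows "primes_below x = set (filter (\<lambda>p. p < x) primes_list_128)"
proof -
  have "filter prime [0..<128] = primes_list_128" by code_simp
  moreover have "primes_below x = set (filter (\<lambda>p. p < x) (filter prime [0..<128]))"
    using assms by (auto simp: primes_below_def)
  ultimately show ?thesis by simp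
qed

lemma card_primes_below:
  "card (primes_below 16) = 6" "card (primes_below 17) = 6" "card (primes_below 18) = 7"
  "card (primes_below 26) = 9" "card (primes_below 62) = 18" "card (primes_below 64) = 18"
  "card (primes_below 68) = 19" "card (primes_below 74) = 21"
  "card (primes_below 102) = 26" "card (primes_below 128) = 31"
  by (simp_all add: primes_below_eq_list primes_list_128_def)

section \<open>Few prime factors\<close>

text \<open>\<open>R\<close> divides \<open>a + 1\<close> for some exponent \<open>a\<close> of
  \<open>n\<close>. Since \<open>P < 2 ^ m <= p ^ m\<close> for every prime \<open>p\<close>, all
  exponents are at most \<open>2 * m - 2\<close>.\<close>

lemma prime_dvd_num_divisors_le:
  assumes n: "highly_composite n" and P: "prime P" "\<not> P dvd n" "P < 2 ^ m"
    and R: "prime R" "R dvd num_divisors n"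
  shows "R < 2 * m"
proof -
  obtain p where p: "p \<in> prime_factors n" "R dvd Suc (multiplicity p n)"
    using R highly_composite_pos[OF n] by (auto simp: num_divisors_eq_prod prime_dvd_prod_iff)
  have "m > 0" using P by (intro gr0I) (auto dest: prime_gt_1_nat)
  have pp: "prime p" using p by auto
  have "P < p ^ m" using P(3) power_mono[of 2 p m] prime_ge_2_nat[OF pp] by simp
  then have "\<not> p ^ (2 * m - 1) dvd n"
    by (intro highly_composite_exponent_bound[OF n P(1,2) pp])
  then have "multiplicity p n < 2 * m - 1"
    using multiplicity_dvd' by (meson not_le)
  moreover have "R \<le> Suc (multiplicity p n)" using p by (intro dvd_imp_le) auto
  ultimately show ?thesis by simp
qed

text \<open>Each prime of exponent exactly 1 contributes a factor 2.\<close>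

lemma two_power_card_dvd_num_divisors:
  assumes "n > 0"
  shows "2 ^ card {p \<in> prime_factors n. \<not> p\<^sup>2 dvd n} dvd num_divisors n"
proof -
  let ?T = "{p \<in> prime_factors n. \<not> p\<^sup>2 dvd n}"
  have "multiplicity p n = 1" if "p \<in> ?T" for p
  proof -
    have "p dvd n" "0 < p" using that by (auto intro: prime_gt_0_nat)
    then show ?thesis using that by (intro multiplicity_eqI) (auto simp: numeral_2_eq_2)
  qed
  then have "2 ^ card ?T = (\<Prod>p\<in>?T. Suc (multiplicity p n))" by (simp add: numeral_2_eq_2)
  also have "\<dots> dvd num_divisors n"
    unfolding num_divisors_eq_prod[OF assms] by (intro prod_dvd_prod_subset) auto
  finally show ?thesis .
qed

text \<open>Two primes \<open>P\<close>, \<open>Q\<close> below \<open>X\<close> are missing from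
  \<open>n\<close>. Three squared primes from \<open>Y\<close> on would give
  \<open>Y ^ 3 <= P * Q < X ^ 2\<close>, so at most two of them occur beyond the primes below
  \<open>Y\<close>. The other prime factors are counted by the exponent of 2 in
  \<open>num_divisors n\<close>, which is at most \<open>2 * u - 2\<close> because \<open>R\<close>
  does not divide that number.\<close>

lemma card_prime_factors_le:
  assumes n: "highly_composite n" and d: "highly_composite (num_divisors n)"
    and card: "card (prime_factors n) + 2 \<le> card (primes_below X)"
    and m: "X \<le> 2 ^ m" and Y: "X\<^sup>2 \<le> Y ^ 3"
    and R: "prime R" "2 * m \<le> R" "R < 2 ^ u"
  shows "card (prime_factors n) \<le> card (primes_below Y) + 2 * u"
proof -
  let ?F = "prime_factors n"
  have "2 \<le> card (primes_below X - ?F)"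
    using card diff_card_le_card_Diff[of ?F "primes_below X"] by simp
  then obtain S where S: "S \<subseteq> primes_below X - ?F" "card S = 2"
    by (meson obtain_subset_with_card_n)
  then obtain P Q where PQ: "P \<in> primes_below X - ?F" "Q \<in> primes_below X - ?F" "P \<noteq> Q"
    by (auto simp: card_2_iff)
  have P: "prime P" "\<not> P dvd n" "P < X" and Q: "prime Q" "\<not> Q dvd n" "Q < X"
    using PQ highly_composite_pos[OF n] by (auto simp: primes_below_def prime_factors_dvd)
  define H where "H = {p \<in> ?F. p\<^sup>2 dvd n}"
  define T where "T = {p \<in> ?F. \<not> p\<^sup>2 dvd n}"
  have "card {p \<in> H. Y \<le> p} \<le> 2"
  proof (rule ccontr)
    assume "\<not> ?thesis"
    then have "3 \<le> card {p \<in> H. Y \<le> p}" by simp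
    then obtain S where S: "S \<subseteq> {p \<in> H. Y \<le> p}" "card S = 3"
      by (meson obtain_subset_with_card_n)
    then obtain a b c where abc: "S = {a, b, c}" "a \<noteq> b" "a \<noteq> c" "b \<noteq> c"
      by (auto simp: card_3_iff)
    have "Y ^ 3 \<le> a * b * c"
      using S abc by (auto simp: power3_eq_cube intro!: mult_mono)
    also have "\<dots> \<le> P * Q"
      using S abc by (intro highly_composite_three_squares[OF n P(1,2) Q(1,2) PQ(3)]) (auto simp: H_def)
    also have "\<dots> < X * X" using P Q by (intro mult_strict_mono) auto
    finally show False using Y by (simp add: power2_eq_square)
  qed
  moreover have "card H \<le> card (primes_below Y) + card {p \<in> H. Y \<le> p}"
  proof -
    have "H \<subseteq> primes_below Y \<union> {p \<in> H. Y \<le> p}" by (auto simp: H_def primes_below_def)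
    then have "card H \<le> card (primes_below Y \<union> {p \<in> H. Y \<le> p})" by (intro card_mono) (auto simp: H_def)
    also have "\<dots> \<le> card (primes_below Y) + card {p \<in> H. Y \<le> p}" by (rule card_Un_le)
    finally show ?thesis .
  qed
  moreover have "card T < 2 * u - 1"
  proof -
    have "\<not> R dvd num_divisors n"
      using prime_dvd_num_divisors_le[OF n P(1,2) less_le_trans[OF P(3) m] R(1)] R(2) by auto
    \<comment> \<open>The exponent bound is now applied to \<open>num_divisors n\<close>, with
      missing prime \<open>R < 2 ^ u\<close>.\<close>
    then have "\<not> 2 ^ (2 * u - 1) dvd num_divisors n"
      using highly_composite_exponent_bound[OF d R(1) _ two_is_prime_nat R(3)] by blast
    then show ?thesis
      using two_power_card_dvd_num_divisors[OF highly_composite_pos[OF n]]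
      unfolding T_def by (meson dvd_trans le_imp_power_dvd not_le)
  qed
  moreover have "card ?F = card H + card T"
    unfolding H_def T_def by (subst card_Un_disjoint[symmetric]) (auto intro: arg_cong[where f = card])
  ultimately show ?thesis by linarith
qed

text \<open>For \<open>X = 2 ^ s\<close> and \<open>Y = 2 ^ (c + 1)\<close> the first condition is
  \<open>X ^ 2 <= Y ^ 3\<close>. Raising \<open>s\<close> by 3 and \<open>c\<close> by 2 multiplies
  the left side of the second by at most 2 * 4 and the right side by 8, so the three base cases 12,
  13, 14 suffice.\<close>

lemma two_thirds_exponent:
  fixes s :: nat
  assumes "12 \<le> s"
  shows "\<exists>c. 2 * s \<le> 3 * c + 3 \<and> (s - 1) * (2 ^ c + 2 * s + 2) < 2 ^ (s - 1)"
  using assms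
proof (induction s rule: less_induct)
  case (less s)
  consider "s = 12" | "s = 13" | "s = 14" | "15 \<le> s" using less.prems by linarith
  then show ?case
  proof cases
    case 1 then show ?thesis by (intro exI[of _ 7]) simp
  next
    case 2 then show ?thesis by (intro exI[of _ 8]) simp
  next
    case 3 then show ?thesis by (intro exI[of _ 9]) simp
  next
    case 4
    define t where "t = s - 4"
    have t: "s = t + 4" "11 \<le> t" using 4 by (auto simp: t_def)
    obtain c where c: "2 * (t + 1) \<le> 3 * c + 3" "t * (2 ^ c + 2 * (t + 1) + 2) < 2 ^ t"
      using less.IH[of "t + 1"] t by auto
    have "(t + 3) * (2 ^ (c + 2) + 2 * (t + 4) + 2) \<le> 2 * t * (4 * (2 ^ c + 2 * (t + 1) + 2))"
      using t by (intro mult_mono) (auto simp: power_add)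
    also have "\<dots> = 8 * (t * (2 ^ c + 2 * (t + 1) + 2))" by (simp add: algebra_simps)
    also have "\<dots> < 8 * 2 ^ t" using c(2) by simp
    also have "\<dots> = 2 ^ (t + 3)" by (simp add: power_add)
    finally have less: "(t + 3) * (2 ^ (c + 2) + 2 * (t + 4) + 2) < 2 ^ (t + 3)" .
    have "s - 1 = t + 3" "2 * s \<le> 3 * (c + 2) + 3" using c(1) t by auto
    then show ?thesis using less t(1) by (intro exI[of _ "c + 2"]) (simp only:)
  qed
qed

text \<open>Take \<open>X = 2 ^ s\<close> with \<open>s\<close> minimal such that Chebyshev's bound provides \<open>w + 2\<close> primes below
  \<open>X\<close>. Then \<open>w\<close> is of order \<open>2 ^ s / s\<close>, but is bounded by \<open>Y / 2 + 2 * s\<close>, where \<open>Y\<close> is of order \<open>X powr (2/3)\<close>.\<close>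

lemma card_prime_factors_less_186:
  assumes n: "highly_composite n" and d: "highly_composite (num_divisors n)"
  shows "card (prime_factors n) < 186"
proof (rule ccontr)
  define w where "w = card (prime_factors n)"
  assume "\<not> ?thesis"
  then have w: "186 \<le> w" by (simp add: w_def)
  define Q where "Q s \<longleftrightarrow> 0 < s \<and> s * (w + 2) + 1 \<le> 2 ^ s" for s :: nat
  define s where "s = (LEAST s. Q s)"
  \<comment> \<open>Taken at \<open>k = w + 2\<close>, this shows that some \<open>s\<close>
    satisfies \<open>Q\<close>, so the least one does.\<close>
  have "k * k + 1 \<le> 2 ^ k" if "5 \<le> k" for k :: nat
    using that
  proof (induction k rule: dec_induct)
    case (step k)
    then have "5 * k \<le> k * k" by (intro mult_right_mono) auto
    moreover have "Suc k * Suc k + 1 = k * k + 2 * k + 2" "(2::nat) ^ Suc k = 2 * 2 ^ k" by auto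
    ultimately show ?case using step by linarith
  qed simp
  from this[of "w + 2"] have "Q (w + 2)" using w by (simp add: Q_def)
  then have Qs: "Q s" unfolding s_def by (rule LeastI)
  have "12 \<le> s"
  proof (rule ccontr)
    assume "\<not> 12 \<le> s"
    then have "s \<in> set [1..<12]" using Qs by (simp add: Q_def)
    \<comment> \<open>188 is 186 + 2; the tightest case is \<open>t = 11\<close>, where 2048 <
      2069.\<close>
    moreover have "\<forall>t\<in>set [1..<12]. 2 ^ t < t * 188 + (1::nat)" by code_simp
    ultimately have "2 ^ s < s * 188 + 1" by blast
    also have "\<dots> \<le> s * (w + 2) + 1" using w by simp
    finally show False using Qs by (simp add: Q_def)
  qed
  then obtain c where c: "2 * s \<le> 3 * c + 3" "(s - 1) * (2 ^ c + 2 * s + 2) < 2 ^ (s - 1)"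
    using two_thirds_exponent by blast
  \<comment> \<open>Minimality of \<open>s\<close> turns into a lower bound for
    \<open>w\<close>.\<close>
  have "\<not> Q (s - 1)"
    using not_less_Least[of "s - 1" Q] \<open>12 \<le> s\<close> by (simp add: s_def[symmetric])
  then have "2 ^ (s - 1) \<le> (s - 1) * (w + 2)" using \<open>12 \<le> s\<close> by (simp add: Q_def)
  then have "(s - 1) * (2 ^ c + 2 * s + 2) < (s - 1) * (w + 2)" using c by linarith
  then have big: "2 ^ c + 2 * s < w" by simp
  have "s * (w + 2) \<le> s * card (primes_below (2 ^ s))"
    using Qs card_primes_below_power_2_ge[of s] \<open>12 \<le> s\<close> unfolding Q_def by linarith
  then have pc: "w + 2 \<le> card (primes_below (2 ^ s))"
    using \<open>12 \<le> s\<close> by (simp only: mult_le_cancel1)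
  \<comment> \<open>There are more primes below \<open>2 ^ s\<close> than below
    \<open>2 * s\<close>, which yields a prime \<open>R\<close> in between; so
    \<open>m = u = s\<close> is possible in the counting lemma.\<close>
  have "card (primes_below (2 * s)) < card (primes_below (2 ^ s))"
    using card_primes_below_le[of s] \<open>12 \<le> s\<close> big pc by linarith
  then have "\<not> primes_below (2 ^ s) \<subseteq> primes_below (2 * s)"
    by (meson card_mono finite_primes_below not_le)
  then obtain R where "R \<in> primes_below (2 ^ s)" "R \<notin> primes_below (2 * s)" by blast
  then have R: "prime R" "2 * s \<le> R" "R < 2 ^ s" by (auto simp: primes_below_def)
  have "((2::nat) ^ s)\<^sup>2 \<le> (2 ^ (c + 1)) ^ 3"
    unfolding power_mult[symmetric] using c(1) by (intro power_increasing) auto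
  then have "w \<le> card (primes_below (2 ^ (c + 1))) + 2 * s"
    unfolding w_def
    by (intro card_prime_factors_le[OF n d pc[unfolded w_def] order_refl _ R])
  also have "\<dots> \<le> 2 ^ c + 2 * s" using card_primes_below_le[of "2 ^ c"] by simp
  finally show False using big by simp
qed

text \<open>Otherwise all 15 primes up to 47 divide \<open>n\<close>, so the number of prime factors
  lies between 15 and 185. This range is cut into intervals, each excluded by its own
  parameters.\<close>

lemma exists_prime_not_dvd:
  assumes n: "highly_composite n" and d: "highly_composite (num_divisors n)"
  shows "\<exists>P. prime P \<and> P \<le> 47 \<and> \<not> P dvd n"
proof (rule ccontr)
  assume "\<not> ?thesis"
  then have "{2, 3, 5, 7, 11, 13, 17, 19, 23, 29, 31, 37, 41, 43, 47} \<subseteq> prime_factors n"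
    using highly_composite_pos[OF n] by (auto simp: prime_factors_dvd)
  from card_mono[OF _ this] have ge: "15 \<le> card (prime_factors n)" by simp
  have block: "card (prime_factors n) \<le> card (primes_below Y) + 2 * u"
    if "card (prime_factors n) + 2 \<le> card (primes_below X)" "X \<le> 2 ^ m" "X\<^sup>2 \<le> Y ^ 3"
      "prime R" "2 * m \<le> R" "R < 2 ^ u" for X Y m R u
    using card_prime_factors_le[OF n d] that by blast
  note C = card_primes_below
  \<comment> \<open>The instances are \<open>X\<close>, \<open>m\<close>, \<open>Y\<close>,
    \<open>R\<close>, \<open>u\<close>. At the upper end of each interval \<open>X\<close> still
    provides two spare primes, and the resulting bound lies below the lower end.\<close>
  have "\<not> card (prime_factors n) \<le> 16"
    using block[of 62 6 16 13 4] ge C by auto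
  moreover have "card (prime_factors n) \<noteq> 17"
    using block[of 68 7 17 17 5] C by auto
  moreover have "\<not> (18 \<le> card (prime_factors n) \<and> card (prime_factors n) \<le> 19)"
    using block[of 74 7 18 17 5] C by auto
  moreover have "\<not> (20 \<le> card (prime_factors n) \<and> card (prime_factors n) \<le> 29)"
    using block[of 128 7 26 17 5] C by auto
  moreover have "\<not> (30 \<le> card (prime_factors n) \<and> card (prime_factors n) \<le> 55)"
    using block[of 512 9 64 19 5] C card_primes_below_power_2_ge[of 9] by auto
  moreover have "\<not> (56 \<le> card (prime_factors n) \<and> card (prime_factors n) \<le> 101)"
    using block[of 1024 10 102 23 5] C card_primes_below_power_2_ge[of 10] by auto
  moreover have "\<not> (102 \<le> card (prime_factors n) \<and> card (prime_factors n) \<le> 185)"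
    using block[of 2048 11 162 23 5] card_primes_below_le[of 81] card_primes_below_power_2_ge[of 11] by auto
  moreover note card_prime_factors_less_186[OF n d] ge
  ultimately show False by linarith
qed

section \<open>Pareto frontiers\<close>

text \<open>For distinct primes these are the divisors of the product of all
  \<open>p ^ A\<close>.\<close>

fun box :: "(nat \<times> nat) list \<Rightarrow> nat set" where
  "box [] = {1}"
| "box ((p, A) # ps) = {p ^ a * x | a x. a \<le> A \<and> x \<in> box ps}"

text \<open>The branches are selected by auxiliary functions because the simplifier normalises the
  selected branch of a conditional afresh, which would make the evaluation below much slower.
  Correctness does not need sorted lists, as \<open>sweep\<close> tests domination explicitly.\<close>

function (sequential)
  merge :: "(nat \<times> nat) list \<Rightarrow> (nat \<times> nat) list \<Rightarrow> (nat \<times> nat) list" and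
  merge_step :: "bool \<Rightarrow> nat \<times> nat \<Rightarrow> (nat \<times> nat) list \<Rightarrow> nat \<times> nat \<Rightarrow> (nat \<times> nat) list \<Rightarrow> (nat \<times> nat) list"
where
  "merge [] ys = ys"
| "merge (x # xs) [] = x # xs"
| "merge (x # xs) (y # ys) = merge_step (fst x \<le> fst y) x xs y ys"
| "merge_step True x xs y ys = x # merge xs (y # ys)"
| "merge_step False x xs y ys = y # merge (x # xs) ys"
  by pat_completeness auto
termination
  by (relation "measure (case_sum (\<lambda>(xs, ys). 2 * (length xs + length ys))
    (\<lambda>(_, _, xs, _, ys). 2 * (length xs + length ys) + 3))") auto

text \<open>Pairs hold a number and its number of divisors. On a list sorted by number, the last
  kept entry \<open>b\<close> has the most divisors so far, so comparing with \<open>b\<close> alone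
  finds every dominated entry.\<close>

function (sequential)
  sweep :: "nat \<times> nat \<Rightarrow> (nat \<times> nat) list \<Rightarrow> (nat \<times> nat) list" and
  sweep_step :: "bool \<Rightarrow> nat \<times> nat \<Rightarrow> nat \<times> nat \<Rightarrow> (nat \<times> nat) list \<Rightarrow> (nat \<times> nat) list"
where
  "sweep b [] = [b]"
| "sweep b (x # xs) = sweep_step (fst b \<le> fst x \<and> snd x \<le> snd b) b x xs"
| "sweep_step True b x xs = sweep b xs"
| "sweep_step False b x xs = b # sweep x xs"
  by pat_completeness auto
termination
  by (relation "measure (case_sum (\<lambda>(_, xs). 2 * length xs) (\<lambda>(_, _, _, xs). 2 * length xs + 1))") auto

fun prune :: "(nat \<times> nat) list \<Rightarrow> (nat \<times> nat) list" where
  "prune [] = []"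
| "prune (x # xs) = sweep x xs"

definition extend :: "nat \<Rightarrow> nat \<Rightarrow> (nat \<times> nat) list \<Rightarrow> (nat \<times> nat) list" where
  "extend p A L =
    foldr (\<lambda>a M. prune (merge (map (\<lambda>(m, d). (p ^ a * m, Suc a * d)) L) M)) [0..<Suc A] []"

fun frontier :: "(nat \<times> nat) list \<Rightarrow> (nat \<times> nat) list" where
  "frontier [] = [(1, 1)]"
| "frontier ((p, A) # ps) = extend p A (frontier ps)"

section \<open>Domination and correctness of pruning\<close>

definition dominated :: "nat \<times> nat \<Rightarrow> (nat \<times> nat) set \<Rightarrow> bool" where
  "dominated x S \<longleftrightarrow> (\<exists>y\<in>S. fst y \<le> fst x \<and> snd x \<le> snd y)"

lemma dominated_refl: "x \<in> S \<Longrightarrow> dominated x S"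
  by (auto simp: dominated_def)

lemma dominated_trans:
  "dominated x S \<Longrightarrow> (\<And>y. y \<in> S \<Longrightarrow> dominated y T) \<Longrightarrow> dominated x T"
  unfolding dominated_def by (meson order_trans)

lemma dominated_mono: "dominated x S \<Longrightarrow> S \<subseteq> T \<Longrightarrow> dominated x T"
  by (auto simp: dominated_def)

lemma
  set_merge [simp]: "set (merge xs ys) = set xs \<union> set ys" and
  set_merge_step: "set (merge_step c x xs y ys) = {x, y} \<union> set xs \<union> set ys"
  by (induction xs ys and c x xs y ys rule: merge_merge_step.induct) auto

lemma
  set_sweep: "set (sweep b xs) \<subseteq> insert b (set xs)" and
  set_sweep_step: "set (sweep_step c b x xs) \<subseteq> {b, x} \<union> set xs"
  by (induction b xs and c b x xs rule: sweep_sweep_step.induct) auto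

lemma set_prune: "set (prune xs) \<subseteq> set xs"
  using set_sweep by (cases xs) auto

lemma dominated_sweep: "x \<in> insert b (set xs) \<Longrightarrow> dominated x (set (sweep b xs))"
proof (induction xs arbitrary: b x)
  case Nil
  then show ?case by (simp add: dominated_refl)
next
  case (Cons y ys)
  show ?case
  proof (cases "fst b \<le> fst y \<and> snd y \<le> snd b")
    case True
    then have eq: "sweep b (y # ys) = sweep b ys" by simp
    \<comment> \<open>The dropped \<open>y\<close> is beaten by \<open>b\<close>, and
      \<open>b\<close> by a surviving entry.\<close>
    have "dominated y (set (sweep b ys))"
      using Cons.IH[of b b] True unfolding dominated_def by (meson insertI1 order_trans)
    then show ?thesis
      using Cons unfolding eq by (metis insert_iff list.simps(15))
  next
    case False
    then have eq: "sweep b (y # ys) = b # sweep y ys"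
      by (simp only: sweep.simps sweep_step.simps)
    show ?thesis
    proof (cases "x = b")
      case True
      then show ?thesis unfolding eq by (simp add: dominated_refl)
    next
      case neq: False
      have "dominated x (set (sweep y ys))"
        using Cons neq by auto
      then show ?thesis unfolding eq by (rule dominated_mono) auto
    qed
  qed
qed

lemma dominated_prune: "x \<in> set xs \<Longrightarrow> dominated x (set (prune xs))"
  using dominated_sweep by (cases xs) auto

lemma foldr_prune:
  defines "F \<equiv> \<lambda>f as. foldr (\<lambda>a M. prune (merge (f a) M)) as []"
  shows "set (F f as) \<subseteq> (\<Union>a\<in>set as. set (f a))"
    and "x \<in> (\<Union>a\<in>set as. set (f a)) \<Longrightarrow> dominated x (set (F f as))"
proof (induction as arbitrary: x)
  case Nil
  {
    case 1 show ?case by (simp add: F_def)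
  next
    case 2 then show ?case by simp
  }
next
  case (Cons a as)
  have F: "F f (a # as) = prune (merge (f a) (F f as))" by (simp add: F_def)
  {
    case 1
    show ?case using Cons.IH(1) set_prune unfolding F by fastforce
  next
    case 2
    then consider "x \<in> set (f a)" | "x \<in> (\<Union>a\<in>set as. set (f a))" by (simp only: set_simps) blast
    then have "dominated x (set (merge (f a) (F f as)))"
    proof cases
      case 1
      then show ?thesis by (intro dominated_refl) simp
    next
      case 2
      then show ?thesis by (intro dominated_mono[OF Cons.IH(2)[OF 2]]) simp
    qed
    then show ?case unfolding F by (rule dominated_trans) (rule dominated_prune)
  }
qed

lemma set_extend:
  assumes "(m, d) \<in> set (extend p A L)"
  obtains a m' d' where "a \<le> A" "(m', d') \<in> set L" "m = p ^ a * m'" "d = Suc a * d'"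
proof -
  have "(m, d) \<in> (\<Union>a\<in>set [0..<Suc A]. set (map (\<lambda>(m, d). (p ^ a * m, Suc a * d)) L))"
    using subsetD[OF foldr_prune(1) assms[unfolded extend_def]] .
  then obtain a where a: "a \<in> set [0..<Suc A]" "(m, d) \<in> set (map (\<lambda>(m, d). (p ^ a * m, Suc a * d)) L)"
    by blast
  then obtain m' d' where L: "(m', d') \<in> set L" "m = p ^ a * m'" "d = Suc a * d'" by auto
  have "a \<le> A" using a(1) by auto
  then show ?thesis using L by (rule that)
qed

text \<open>Multiplication by \<open>p ^ a\<close> preserves both inequalities of domination, so
  pruning before the next prime is harmless.\<close>

lemma dominated_extend:
  assumes "a \<le> A" "dominated (m, d) (set L)"
  shows "dominated (p ^ a * m, Suc a * d) (set (extend p A L))"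
proof -
  obtain m' d' where y: "(m', d') \<in> set L" "m' \<le> m" "d \<le> d'"
    using assms by (auto simp: dominated_def)
  have "dominated (p ^ a * m', Suc a * d') (set (extend p A L))"
    unfolding extend_def using y(1) assms(1) by (intro foldr_prune(2)) force
  moreover have "p ^ a * m' \<le> p ^ a * m" "Suc a * d \<le> Suc a * d'"
    using y by (simp_all only: mult_le_mono2)
  ultimately show ?thesis
    unfolding dominated_def fst_conv snd_conv by (meson order_trans)
qed

section \<open>Soundness and completeness of the frontier\<close>

lemma prime_not_dvd_box:
  assumes "prime p" "\<And>q. q \<in> fst ` set ps \<Longrightarrow> prime q" "p \<notin> fst ` set ps" "x \<in> box ps"
  shows "\<not> p dvd x"
  using assms
proof (induction ps arbitrary: x)
  case Nil
  then show ?case by (auto dest: prime_gt_1_nat)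
next
  case (Cons qB ps)
  obtain q B where qB: "qB = (q, B)" by (cases qB)
  with Cons.prems obtain b y where x: "x = q ^ b * y" and y: "y \<in> box ps" by auto
  have "\<not> p dvd y" using Cons y by auto
  then show ?case
    unfolding x using Cons.prems qB by (intro prime_not_dvd_prime_power_mult) auto
qed

lemma box_pos: "\<forall>p\<in>fst ` set ps. prime p \<Longrightarrow> x \<in> box ps \<Longrightarrow> 0 < x"
  by (induction ps arbitrary: x) (auto simp: prime_gt_0_nat)

lemma frontier_sound:
  assumes "distinct (map fst ps)" "\<forall>p\<in>fst ` set ps. prime p" "(m, d) \<in> set (frontier ps)"
  shows "m \<in> box ps \<and> num_divisors m = d"
  using assms
proof (induction ps arbitrary: m d)
  case Nil
  then show ?case by (auto simp: num_divisors_def)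
next
  case (Cons pA ps)
  obtain p A where pA: "pA = (p, A)" by (cases pA)
  obtain a m' d' where a: "a \<le> A" "(m', d') \<in> set (frontier ps)" "m = p ^ a * m'" "d = Suc a * d'"
    using Cons.prems(3) unfolding pA by (auto elim: set_extend)
  then have IH: "m' \<in> box ps" "num_divisors m' = d'" using Cons by auto
  have "\<not> p dvd m'" using Cons.prems pA IH by (intro prime_not_dvd_box[of p ps]) auto
  then show ?case
    using Cons.prems IH a unfolding pA by (auto simp: num_divisors_prime_power_mult)
qed

lemma frontier_complete:
  assumes "distinct (map fst ps)" "\<forall>p\<in>fst ` set ps. prime p" "x \<in> box ps"
  shows "dominated (x, num_divisors x) (set (frontier ps))"
  using assms
proof (induction ps arbitrary: x)
  case Nil
  then show ?case by (auto simp: num_divisors_def dominated_def)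
next
  case (Cons pA ps)
  obtain p A where pA: "pA = (p, A)" by (cases pA)
  obtain a y where a: "a \<le> A" "y \<in> box ps" "x = p ^ a * y"
    using Cons.prems(3) unfolding pA by auto
  have "dominated (y, num_divisors y) (set (frontier ps))" using Cons a by auto
  moreover have "\<not> p dvd y" using Cons.prems pA a by (intro prime_not_dvd_box[of p ps]) auto
  ultimately show ?case
    using Cons.prems a dominated_extend[of a A y "num_divisors y" "frontier ps" p]
    unfolding pA by (auto simp: num_divisors_prime_power_mult)
qed

text \<open>Some frontier entry \<open>m <= n\<close> has at least as many divisors as
  \<open>n\<close>; high compositeness forces \<open>m = n\<close>.\<close>

lemma highly_composite_in_frontier:
  assumes "distinct (map fst ps)" "\<forall>p\<in>fst ` set ps. prime p" "n \<in> box ps" "highly_composite n"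
  shows "(n, num_divisors n) \<in> set (frontier ps)"
proof -
  obtain m d where md: "(m, d) \<in> set (frontier ps)" "m \<le> n" "num_divisors n \<le> d"
    using frontier_complete[OF assms(1-3)] by (auto simp: dominated_def)
  then have "m \<in> box ps" "num_divisors m = d" using frontier_sound[OF assms(1,2)] by blast+
  moreover from this have "n \<le> m"
    using md box_pos[OF assms(2)] by (intro highly_composite_le[OF assms(4)]) auto
  ultimately show ?thesis using md by simp
qed

lemma in_boxI:
  assumes "distinct (map fst ps)" "\<forall>p\<in>fst ` set ps. prime p" "0 < n"
    and "\<And>p. prime p \<Longrightarrow> p dvd n \<Longrightarrow> p \<in> fst ` set ps"
    and "\<And>p A. (p, A) \<in> set ps \<Longrightarrow> \<not> p ^ Suc A dvd n"
  shows "n \<in> box ps"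
  using assms
proof (induction ps arbitrary: n)
  case Nil
  then have "\<not> (\<exists>p. prime p \<and> p dvd n)" by auto
  then show ?case using prime_factor_nat by auto
next
  case (Cons pA ps)
  obtain p A where pA: "pA = (p, A)" by (cases pA)
  then have p: "prime p" using Cons.prems by simp
  obtain w where w: "n = p ^ multiplicity p n * w" "\<not> p dvd w" "0 < w"
    using prime_power_split[OF Cons.prems(3) p] .
  then have "w dvd n" by (metis dvd_triv_right)
  have "w \<in> box ps"
  proof (rule Cons.IH)
    show "q \<in> fst ` set ps" if "prime q" "q dvd w" for q
      using Cons.prems(4)[of q] that \<open>w dvd n\<close> w(2) pA by (auto intro: dvd_trans)
    show "\<not> q ^ Suc B dvd w" if "(q, B) \<in> set ps" for q B
      using Cons.prems(5)[of q B] that \<open>w dvd n\<close> by (auto intro: dvd_trans)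
  qed (use Cons.prems w in auto)
  moreover have "multiplicity p n \<le> A"
    using Cons.prems(5)[of p A] pA multiplicity_dvd'[of "Suc A" p n] by (meson list.set_intros(1) not_less_eq_eq)
  ultimately show ?case unfolding pA using w(1) by auto
qed

section \<open>The finite search\<close>

text \<open>The caps are those forced by a missing prime up to 47. The recursion of
  \<open>frontier\<close> starts at the end of the list, so 2 is processed first.\<close>

definition search_box :: "(nat \<times> nat) list" where
  "search_box = [(43, 1), (41, 1), (37, 1), (31, 1), (29, 1), (23, 1), (19, 1), (17, 1),
     (13, 2), (11, 2), (7, 2), (5, 4), (3, 6), (2, 10)]"

lemma search_box_primes:
  "distinct (map fst search_box)" "\<forall>p\<in>fst ` set search_box. prime p"
  by (simp_all add: search_box_def)

lemma in_search_box:
  assumes n: "highly_composite n" and P: "prime P" "P \<le> 47" "\<not> P dvd n"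
  shows "n \<in> box search_box"
proof (rule in_boxI[OF search_box_primes highly_composite_pos[OF n]])
  note bound = highly_composite_exponent_bound[OF n P(1,3)]
  fix p assume p: "prime p" "p dvd n"
  \<comment> \<open>The case \<open>m = 1\<close> of the bound: no prime above the missing
    \<open>P\<close> divides \<open>n\<close>.\<close>
  have "p \<le> P" using bound[OF p(1), of 1] p(2) by (cases "P < p") auto
  moreover have "p \<noteq> P" using p P by auto
  ultimately have "p \<in> primes_below 47" using p P by (simp add: primes_below_def)
  then show "p \<in> fst ` set search_box"
    by (auto simp: primes_below_eq_list primes_list_128_def search_box_def)
next
  note bound = highly_composite_exponent_bound[OF n P(1,3)]
  \<comment> \<open>47 is less than \<open>2 ^ 6\<close>, \<open>3 ^ 4\<close>,
    \<open>5 ^ 3\<close>, \<open>7 ^ 2\<close>, \<open>11 ^ 2\<close> and \<open>13 ^ 2\<close>; an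
    exponent \<open>m\<close> here excludes the power \<open>2 * m - 1\<close>.\<close>
  have "\<not> 2 ^ 11 dvd n" "\<not> 3 ^ 7 dvd n" "\<not> 5 ^ 5 dvd n"
    "\<not> 7 ^ 3 dvd n" "\<not> 11 ^ 3 dvd n" "\<not> 13 ^ 3 dvd n"
    using bound[of 2 6] bound[of 3 4] bound[of 5 3] bound[of 7 2] bound[of 11 2] bound[of 13 2] P(2)
    by simp_all
  moreover have "\<not> 17\<^sup>2 dvd n" "\<not> 19\<^sup>2 dvd n" "\<not> 23\<^sup>2 dvd n" "\<not> 29\<^sup>2 dvd n"
    "\<not> 31\<^sup>2 dvd n" "\<not> 37\<^sup>2 dvd n" "\<not> 41\<^sup>2 dvd n" "\<not> 43\<^sup>2 dvd n"
    by (rule highly_composite_not_square_dvd[OF n P(1,3,2)]; simp)+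
  moreover fix p A assume "(p, A) \<in> set search_box"
  ultimately show "\<not> p ^ Suc A dvd n"
    by (auto simp: search_box_def)
qed

section \<open>The table of solutions and its comparison with the frontier\<close>

definition both_hc :: "nat list" where
  "both_hc = [1, 2, 6, 12, 60, 360, 1260, 2520, 5040, 55440, 277200, 720720, 3603600,
     61261200, 2205403200, 293318625600, 6746328388800, 195643523275200]"

definition both_hc_divisors :: "nat list" where
  "both_hc_divisors =
     [1, 2, 4, 6, 12, 24, 36, 48, 60, 120, 180, 240, 360, 720, 1680, 5040, 10080, 20160]"

text \<open>Only neighbours are compared, which is cheap to evaluate; transitivity extends it to all
  pairs.\<close>

definition strict_chain :: "(nat \<times> nat) list \<Rightarrow> bool" where
  "strict_chain = successively (\<lambda>x y. fst x < fst y \<and> snd x < snd y)"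

lemma strict_chain_sorted:
  "strict_chain L \<longleftrightarrow> sorted_wrt (\<lambda>x y. fst x < fst y \<and> snd x < snd y) L"
  unfolding strict_chain_def by (intro successively_conv_sorted_wrt transpI) auto

lemma strict_chain_le:
  assumes "strict_chain L" "(m, d) \<in> set L" "(m', d') \<in> set L" "d \<le> d'"
  shows "m \<le> m'"
  using assms unfolding strict_chain_sorted by (induction L) fastforce+

text \<open>A single simultaneous pass over two increasing lists replaces a membership test per
  entry. Boolean arguments select the branch, as in \<open>merge\<close>.\<close>

function (sequential)
  select :: "nat list \<Rightarrow> (nat \<times> nat) list \<Rightarrow> (nat \<times> nat) list" and
  select_step :: "bool \<Rightarrow> bool \<Rightarrow> nat \<Rightarrow> nat list \<Rightarrow> nat \<times> nat \<Rightarrow> (nat \<times> nat) list \<Rightarrow> (nat \<times> nat) list"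
where
  "select [] ys = []"
| "select (k # ks) [] = []"
| "select (k # ks) (y # ys) = select_step (k < snd y) (k = snd y) k ks y ys"
| "select_step True e k ks y ys = select ks (y # ys)"
| "select_step False True k ks y ys = y # select ks ys"
| "select_step False False k ks y ys = select (k # ks) ys"
  by pat_completeness auto
termination
  by (relation "measure (case_sum (\<lambda>(ks, ys). 2 * (length ks + length ys))
    (\<lambda>(_, _, _, ks, _, ys). 2 * (length ks + length ys) + 3))") auto

lemma select_Cons:
  "select (k # ks) (y # ys) =
    (if k < snd y then select ks (y # ys) else if k = snd y then y # select ks ys
     else select (k # ks) ys)"
  by (cases "k < snd y"; cases "k = snd y") simp_all

lemma set_select:
  assumes "sorted_wrt (<) ks" "sorted_wrt (<) (map snd ys)"
  shows "set (select ks ys) = {y \<in> set ys. snd y \<in> set ks}"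
  using assms
proof (induction "length ks + length ys" arbitrary: ks ys rule: less_induct)
  case less
  show ?case
  proof (cases ks)
    case Nil
    then show ?thesis by simp
  next
    case ks: (Cons k ks')
    show ?thesis
    proof (cases ys)
      case Nil
      then show ?thesis using ks by simp
    next
      case ys: (Cons y ys')
      consider "k < snd y" | "k = snd y" | "snd y < k" by (rule linorder_cases)
      then show ?thesis
      proof cases
        case 1
        then have "set (select ks ys) = {y \<in> set ys. snd y \<in> set ks'}"
          using less.hyps[of ks' ys] less.prems ks ys by (simp add: select_Cons)
        then show ?thesis using 1 less.prems ks ys by fastforce
      next
        case 2
        then have "set (select ks ys) = insert y {y \<in> set ys'. snd y \<in> set ks'}"
          using less.hyps[of ks' ys'] less.prems ks ys by (simp add: select_Cons)
        then show ?thesis using 2 less.prems ks ys by fastforce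
      next
        case 3
        then have "set (select ks ys) = {y \<in> set ys'. snd y \<in> set ks}"
          using less.hyps[of ks ys'] less.prems ks ys by (simp add: select_Cons)
        then show ?thesis using 3 less.prems ks ys by fastforce
      qed
    qed
  qed
qed

text \<open>Selecting by \<open>map fst L\<close> keeps the entries whose divisor count is itself a
  number on the frontier. Both checks share the argument \<open>L\<close>, so one evaluation result
  covers them.\<close>

definition frontier_ok :: "(nat \<times> nat) list \<Rightarrow> bool" where
  "frontier_ok L \<longleftrightarrow>
     strict_chain L \<and> select (map fst L) L = zip both_hc both_hc_divisors"

lemma frontier_ok_search_box: "frontier_ok (frontier search_box)"
  by code_simp

lemma strict_chain_frontier: "strict_chain (frontier search_box)"
  using frontier_ok_search_box by (simp add: frontier_ok_def)

lemma frontier_divisors_in_frontier: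
  "(n, e) \<in> set (frontier search_box) \<and> (\<exists>f. (e, f) \<in> set (frontier search_box)) \<longleftrightarrow>
     (n, e) \<in> set (zip both_hc both_hc_divisors)"
proof -
  let ?L = "frontier search_box"
  have "sorted_wrt (<) (map fst ?L)" "sorted_wrt (<) (map snd ?L)"
    using strict_chain_frontier unfolding strict_chain_sorted sorted_wrt_map
    by (auto elim: sorted_wrt_mono_rel[rotated])
  then have "set (select (map fst ?L) ?L) = {y \<in> set ?L. snd y \<in> set (map fst ?L)}"
    by (rule set_select)
  then have "set (zip both_hc both_hc_divisors) = {y \<in> set ?L. snd y \<in> set (map fst ?L)}"
    using frontier_ok_search_box by (simp only: frontier_ok_def)
  then show ?thesis by force
qed

text \<open>The constant is the product of the 15 primes up to 47; any smaller positive number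
  misses one of them and so falls under the search.\<close>

lemma prod_first_primes_le:
  assumes "n > 0" "\<And>p. prime p \<Longrightarrow> p \<le> 47 \<Longrightarrow> p dvd n"
  shows "614889782588491410 \<le> (n::nat)"
proof -
  have "(\<Prod>p\<in>primes_below 48. p) = 614889782588491410"
    by (simp add: primes_below_eq_list primes_list_128_def)
  moreover have "(\<Prod>p\<in>primes_below 48. p) dvd (\<Prod>p\<in>prime_factors n. p ^ multiplicity p n)"
  proof (rule prod_dvd_prod_subset2)
    show "primes_below 48 \<subseteq> prime_factors n"
      using assms by (auto simp: primes_below_def prime_factors_dvd)
    show "p dvd p ^ multiplicity p n" if "p \<in> primes_below 48" for p
      using that assms by (intro dvd_power) (auto simp: primes_below_def prime_multiplicity_gt_zero_iff)
  qed simp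
  ultimately have "614889782588491410 dvd n" using prime_factorization_nat[OF assms(1)] by argo
  then show ?thesis using assms(1) by (rule dvd_imp_le)
qed

text \<open>The least number with at least as many divisors as \<open>m\<close> is highly composite, hence itself
  on the frontier.\<close>

lemma highly_composite_if_in_frontier:
  assumes m: "(m, d) \<in> set (frontier search_box)" and small: "m < 614889782588491410"
  shows "highly_composite m"
proof -
  have "m \<in> box search_box" "num_divisors m = d"
    using frontier_sound[OF search_box_primes m] by auto
  then have "0 < m" using box_pos[OF search_box_primes(2)] by simp
  define Q where "Q k \<longleftrightarrow> 0 < k \<and> num_divisors m \<le> num_divisors k" for k
  define k where "k = (LEAST k. Q k)"
  have "Q m" using \<open>0 < m\<close> by (simp add: Q_def)
  then have "Q k" "k \<le> m" unfolding k_def by (rule LeastI, rule Least_le)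
  have "highly_composite k"
    unfolding highly_composite_def
  proof (intro conjI allI impI)
    show "0 < k" using \<open>Q k\<close> by (simp add: Q_def)
    fix j assume j: "0 < j \<and> j < k"
    then have "\<not> Q j" using not_less_Least[of j Q] by (simp add: k_def)
    then show "num_divisors j < num_divisors k" using j \<open>Q k\<close> by (simp add: Q_def)
  qed
  moreover obtain P where "prime P" "P \<le> 47" "\<not> P dvd k"
    using prod_first_primes_le[of k] \<open>Q k\<close> \<open>k \<le> m\<close> small unfolding Q_def by fastforce
  ultimately have "(k, num_divisors k) \<in> set (frontier search_box)"
    using in_search_box highly_composite_in_frontier[OF search_box_primes] by blast
  \<comment> \<open>Along the strict chain, at least as many divisors means at least as
    large.\<close>
  then have "m \<le> k"
    using strict_chain_le[OF strict_chain_frontier m] \<open>Q k\<close> \<open>num_divisors m = d\<close>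
    by (simp add: Q_def)
  then show ?thesis using \<open>highly_composite k\<close> \<open>k \<le> m\<close> by simp
qed

lemma both_highly_composite_iff:
  "highly_composite n \<and> highly_composite (num_divisors n) \<and> num_divisors n = e \<longleftrightarrow>
     (n, e) \<in> set (zip both_hc both_hc_divisors)"
proof
  let ?L = "frontier search_box"
  assume "highly_composite n \<and> highly_composite (num_divisors n) \<and> num_divisors n = e"
  then have n: "highly_composite n" and d: "highly_composite (num_divisors n)" and e: "num_divisors n = e"
    by auto
  obtain P where P: "prime P" "P \<le> 47" "\<not> P dvd n" using exists_prime_not_dvd[OF n d] by blast
  have "(n, e) \<in> set ?L"
    using highly_composite_in_frontier[OF search_box_primes in_search_box[OF n P] n] e by simp
  moreover have p47: "prime (47::nat)" by simp
  \<comment> \<open>As \<open>P < 2 ^ 6\<close>, every prime dividing \<open>num_divisors n\<close>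
    is below 12. Thus 47 is a missing prime for it, and the same search box applies.\<close>
  then have "\<not> 47 dvd num_divisors n"
    using prime_dvd_num_divisors_le[OF n P(1,3), of 6 47] P(2) by auto
  then have "(e, num_divisors e) \<in> set ?L"
    using highly_composite_in_frontier[OF search_box_primes in_search_box[OF d p47 order_refl] d] e by simp
  ultimately show "(n, e) \<in> set (zip both_hc both_hc_divisors)"
    using frontier_divisors_in_frontier by blast
next
  let ?L = "frontier search_box"
  assume zip: "(n, e) \<in> set (zip both_hc both_hc_divisors)"
  then obtain f where f: "(n, e) \<in> set ?L" "(e, f) \<in> set ?L"
    using frontier_divisors_in_frontier by blast
  have "n < 614889782588491410 \<and> e < 614889782588491410"
    using zip by (auto simp: both_hc_def both_hc_divisors_def)
  then have "highly_composite n" "highly_composite e"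
    using f highly_composite_if_in_frontier by blast+
  then show "highly_composite n \<and> highly_composite (num_divisors n) \<and> num_divisors n = e"
    using frontier_sound[OF search_box_primes f(1)] by simp
qed

theorem mainTheorem2:
  shows "{n. highly_composite n \<and> highly_composite (num_divisors n)} =
           {1, 2, 6, 12, 60, 360, 1260, 2520, 5040, 55440, 277200, 720720, 3603600,
            61261200, 2205403200, 293318625600, 6746328388800, 195643523275200}
         \<and> card {n. highly_composite n \<and> highly_composite (num_divisors n)} = 18
         \<and> map num_divisors
           [1, 2, 6, 12, 60, 360, 1260, 2520, 5040, 55440, 277200, 720720, 3603600,
            61261200, 2205403200, 293318625600, 6746328388800, 195643523275200] =
           [1, 2, 4, 6, 12, 24, 36, 48, 60, 120, 180, 240, 360, 720, 1680, 5040, 10080, 20160]"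
proof -
  have len: "length both_hc = length both_hc_divisors"
    by (simp add: both_hc_def both_hc_divisors_def)
  have "n \<in> set both_hc \<longleftrightarrow> (\<exists>e. (n, e) \<in> set (zip both_hc both_hc_divisors))" for n
    using len by (metis in_set_impl_in_set_zip1 in_set_zipE)
  then have eq: "{n. highly_composite n \<and> highly_composite (num_divisors n)} = set both_hc"
    using both_highly_composite_iff by blast
  have "map num_divisors both_hc = both_hc_divisors"
  proof (rule nth_equalityI)
    fix i assume "i < length (map num_divisors both_hc)"
    then have "(both_hc ! i, both_hc_divisors ! i) \<in> set (zip both_hc both_hc_divisors)"
      using len by (auto simp: in_set_zip)
    then have "num_divisors (both_hc ! i) = both_hc_divisors ! i"
      using both_highly_composite_iff by blast
    then show "map num_divisors both_hc ! i = both_hc_divisors ! i"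
      using \<open>i < _\<close> by simp
  qed (simp add: len)
  moreover have "card (set both_hc) = 18" by (simp add: both_hc_def)
  ultimately show ?thesis
    unfolding eq unfolding both_hc_def both_hc_divisors_def by (simp only: list.set)
qed

end
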